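(* Let $L>0$, let $f\colon\mathbb{R}^n\to\mathbb{R}$ be convex and $L$-smooth, let $g\colon\mathbb{R}^n\to\mathbb{R}\cup\{\infty\}$ be closed, convex, and proper, let $F=f+g$ and $F_\star=\inf_{x\in\mathbb{R}^n}F(x)$. Let $K\ge1$ be an integer. Let $\{\varphi_k\}_{k=0}^{K+1}$ be a nonnegative sequence and $\{\tau_k\}_{k=0}^{K}$ a nondecreasing nonnegative sequence such that $\varphi_{K+1}=0$, $\varphi_K=\tau_K=1$, and, for $k=0,1,\dots,K-1$, $$\tau_k\varphi_k-\tau_{k+1}\varphi_{k+1}=\varphi_{k+1}(\tau_{k+1}-\tau_k)+1,\qquad(\tau_k\varphi_k-\tau_{k+1}\varphi_{k+1})(\tau_{k+1}-\tau_k)\le\frac{\tau_{k+1}}2.$$ Let $x_0\in\mathbb{R}^n$, $z_0=x_0$, $x_{-1}^{\oplus}:=x_0$, and let the iterates be generated by G-FISTA-G: $$x_k=\frac{\varphi_{k+1}}{\varphi_k}x_{k-1}^{\oplus}+\left(1-\frac{\varphi_{k+1}}{\varphi_k}\right)z_k\quad(k=0,\dots,K),\qquad z_{k+1}=z_k-\frac{\tau_k\varphi_k-\tau_{k+1}\varphi_{k+1}}{L}\tilde\nabla_LF(x_k)\quad(k=0,\dots,K-1).$$ Then $$\|\tilde\nabla_LF(x_K)\|^2\le 2L\tau_0\left(F(x_0)-F_\star\right).$$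
   Context: $\|\cdot\|$ is the Euclidean norm. $f$ is $L$-smooth if it is differentiable and $\nabla f$ is $L$-Lipschitz. The prox-grad step is $$x^{\oplus}=\operatorname*{arg\,min}_{y\in\mathbb{R}^n}\left\{f(x)+\langle\nabla f(x),y-x\rangle+g(y)+\frac L2\|y-x\|^2\right\},$$ with $x_k^{\oplus}=(x_k)^{\oplus}$ for $k\ge0$, and $\tilde\nabla_LF(x):=-L(x^{\oplus}-x)$. *)

theory Defs
  imports "HOL-Analysis.Analysis"
begin

definition gradient :: "('a::real_inner \<Rightarrow> real) \<Rightarrow> 'a \<Rightarrow> 'a" where
  "gradient f x = (THE D. GDERIV f x :> D)"

definition L_smooth :: "real \<Rightarrow> ('a::euclidean_space \<Rightarrow> real) \<Rightarrow> bool" where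
  "L_smooth L f \<longleftrightarrow> (\<forall>x. f differentiable (at x)) \<and> lipschitz_on L UNIV (gradient f)"

(* Functions into the reals extended by plus infinity are rendered as ereal-valued functions
   that never take the value minus infinity; this exclusion is part of proper_fun. *)

definition proper_fun :: "('a \<Rightarrow> ereal) \<Rightarrow> bool" where
  "proper_fun g \<longleftrightarrow> (\<forall>x. g x \<noteq> -\<infinity>) \<and> (\<exists>x. g x \<noteq> \<infinity>)"

definition ereal_epigraph :: "('a \<Rightarrow> ereal) \<Rightarrow> ('a \<times> real) set" where
  "ereal_epigraph g = {(x, t). g x \<le> ereal t}"

definition closed_fun :: "('a::topological_space \<Rightarrow> ereal) \<Rightarrow> bool" where
  "closed_fun g \<longleftrightarrow> closed (ereal_epigraph g)"

definition convex_fun :: "('a::real_vector \<Rightarrow> ereal) \<Rightarrow> bool" where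
  "convex_fun g \<longleftrightarrow> convex (ereal_epigraph g)"

(* The choice made by arg_min is immaterial: for L > 0 and g closed, convex and proper, the
   objective is strongly convex and has exactly one minimizer. *)

definition prox_grad_step ::
  "real \<Rightarrow> ('a::euclidean_space \<Rightarrow> real) \<Rightarrow> ('a \<Rightarrow> ereal) \<Rightarrow> 'a \<Rightarrow> 'a" where
  "prox_grad_step L f g x =
     arg_min (\<lambda>y. ereal (f x + gradient f x \<bullet> (y - x)) + g y + ereal (L / 2 * (norm (y - x))\<^sup>2))
       (\<lambda>_. True)"

definition grad_map ::
  "real \<Rightarrow> ('a::euclidean_space \<Rightarrow> real) \<Rightarrow> ('a \<Rightarrow> ereal) \<Rightarrow> 'a \<Rightarrow> 'a" where
  "grad_map L f g x = - L *\<^sub>R (prox_grad_step L f g x - x)"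

end

theory Submission
  imports Defs
begin

text \<open>
  Write \<open>y\<^sub>k = x\<^sub>k\<^sub>-\<^sub>1\<^sup>\<oplus>\<close>, \<open>w = x\<^sub>K\<^sup>\<oplus>\<close> and \<open>v\<^sub>k = (z\<^sub>k - y\<^sub>k) / \<phi>\<^sub>k\<close>. The potential
  \<open>U\<^sub>k = \<tau>\<^sub>k (F y\<^sub>k - F w) + L \<langle>v\<^sub>k, z\<^sub>k - w\<rangle>\<close> is nonincreasing: this is the prox-grad inequality
  at \<open>x\<^sub>k\<close>, tested at \<open>y\<^sub>k\<close> with weight \<open>\<tau>\<^sub>k\<close> and at \<open>w\<close> with weight \<open>\<tau>\<^sub>k\<^sub>+\<^sub>1 - \<tau>\<^sub>k\<close>. Since
  \<open>z\<^sub>0 = y\<^sub>0\<close>, \<open>U\<^sub>0 = \<tau>\<^sub>0 (F x\<^sub>0 - F w)\<close>; since \<open>x\<^sub>K = z\<^sub>K\<close>, the prox-grad inequality at \<open>x\<^sub>K\<close>, tested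
  at \<open>y\<^sub>K\<close>, shows that \<open>U\<^sub>K\<close> is at least the squared norm of the last gradient mapping over \<open>2 L\<close>.
\<close>

section \<open>First-order bounds for the smooth term\<close>

lemma gderiv_gradient:
  fixes f :: "'a::euclidean_space \<Rightarrow> real"
  assumes "f differentiable (at x)"
  shows "GDERIV f x :> gradient f x"
proof -
  obtain D where D: "(f has_derivative D) (at x)"
    using assms by (auto simp: differentiable_def)
  have "linear D"
    using D has_derivative_linear by blast
  \<comment> \<open>\<open>adjoint D 1\<close> is the Riesz vector of the functional
    \<open>D\<close>. Since \<open>gradient\<close> is a definite description, its uniqueness is
    shown as well.\<close>
  then have "D h = h \<bullet> adjoint D 1" for h
    using adjoint_works[of D h 1] by simp
  then have "D = (\<lambda>h. h \<bullet> adjoint D 1)"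
    by auto
  with D have ex: "GDERIV f x :> adjoint D 1"
    by (simp add: gderiv_def)
  moreover have "d = adjoint D 1" if "GDERIV f x :> d" for d
  proof -
    have "(\<lambda>h. h \<bullet> d) = (\<lambda>h. h \<bullet> adjoint D 1)"
      using that ex unfolding gderiv_def by (rule has_derivative_unique)
    then have "\<forall>h. h \<bullet> d = h \<bullet> adjoint D 1"
      by meson
    then show ?thesis
      by (simp add: vector_eq_ldot)
  qed
  ultimately show ?thesis
    unfolding gradient_def by (rule theI)
qed

lemma gradient_along_line:
  fixes f :: "'a::euclidean_space \<Rightarrow> real"
  assumes "\<And>x. f differentiable (at x)"
  shows "((\<lambda>t. f (x + t *\<^sub>R d)) has_real_derivative gradient f (x + t *\<^sub>R d) \<bullet> d) (at t)"
proof -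
  have "(f has_derivative (\<lambda>h. h \<bullet> gradient f (x + t *\<^sub>R d))) (at (x + t *\<^sub>R d))"
    using gderiv_gradient[OF assms] by (simp add: gderiv_def)
  moreover have "((\<lambda>t. x + t *\<^sub>R d) has_derivative (\<lambda>s. s *\<^sub>R d)) (at t)"
    by (auto intro!: derivative_eq_intros)
  ultimately have "((\<lambda>t. f (x + t *\<^sub>R d)) has_derivative
      (\<lambda>s. (s *\<^sub>R d) \<bullet> gradient f (x + t *\<^sub>R d))) (at t)"
    by (rule has_derivative_compose[rotated])
  then show ?thesis
    by (simp add: has_field_derivative_def inner_commute mult.commute[of _ "d \<bullet> _"])
qed

text \<open>Restriction to the line through \<open>x\<close> and \<open>y\<close> reduces this to
  the one-dimensional tangent inequality.\<close>

lemma convex_on_above_gradient: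
  fixes f :: "'a::euclidean_space \<Rightarrow> real"
  assumes "convex_on UNIV f" "\<And>x. f differentiable (at x)"
  shows "f x + gradient f x \<bullet> (y - x) \<le> f y"
proof -
  have "convex_on UNIV (\<lambda>t. f (x + t *\<^sub>R (y - x)))"
  proof (rule convex_onI)
    fix t a b :: real assume t: "0 < t" "t < 1"
    have "x + ((1 - t) *\<^sub>R a + t *\<^sub>R b) *\<^sub>R (y - x) =
        (1 - t) *\<^sub>R (x + a *\<^sub>R (y - x)) + t *\<^sub>R (x + b *\<^sub>R (y - x))"
      by (simp add: algebra_simps)
    then show "f (x + ((1 - t) *\<^sub>R a + t *\<^sub>R b) *\<^sub>R (y - x)) \<le>
        (1 - t) * f (x + a *\<^sub>R (y - x)) + t * f (x + b *\<^sub>R (y - x))"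
      using convex_onD[OF assms(1), of t "x + a *\<^sub>R (y - x)" "x + b *\<^sub>R (y - x)"] t by simp
  qed simp
  from convex_on_imp_above_tangent[OF this, of 0 1, OF _ _ _ gradient_along_line[OF assms(2)]]
  show ?thesis
    by simp
qed

lemma L_smooth_descent:
  fixes f :: "'a::euclidean_space \<Rightarrow> real"
  assumes "L_smooth L f"
  shows "f y \<le> f x + gradient f x \<bullet> (y - x) + L / 2 * (norm (y - x))\<^sup>2"
proof -
  define d where "d = y - x"
  \<comment> \<open>Up to a constant, \<open>\<psi>\<close> is \<open>f\<close> along the segment
    minus its quadratic upper model; the Lipschitz bound makes its derivative nonpositive for
    \<open>t\<close> at least 0.\<close>
  define \<psi> where "\<psi> t = f (x + t *\<^sub>R d) - t * (gradient f x \<bullet> d) - L / 2 * t\<^sup>2 * (norm d)\<^sup>2" for t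
  have "\<exists>D. (\<psi> has_real_derivative D) (at t) \<and> D \<le> 0" if "0 \<le> t" for t
  proof (intro exI conjI)
    show "(\<psi> has_real_derivative
        gradient f (x + t *\<^sub>R d) \<bullet> d - gradient f x \<bullet> d - L * t * (norm d)\<^sup>2) (at t)"
      unfolding \<psi>_def
      by (rule derivative_eq_intros gradient_along_line refl | use assms in \<open>simp add: L_smooth_def\<close>)+
    have "gradient f (x + t *\<^sub>R d) \<bullet> d - gradient f x \<bullet> d
        \<le> norm (gradient f (x + t *\<^sub>R d) - gradient f x) * norm d"
      by (metis inner_diff_left norm_cauchy_schwarz)
    also have "norm (gradient f (x + t *\<^sub>R d) - gradient f x) \<le> L * (t * norm d)"
      using assms that lipschitz_onD[of L UNIV "gradient f" "x + t *\<^sub>R d" x]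
      by (simp add: L_smooth_def dist_norm)
    finally show "gradient f (x + t *\<^sub>R d) \<bullet> d - gradient f x \<bullet> d - L * t * (norm d)\<^sup>2 \<le> 0"
      by (simp add: power2_eq_square mult_right_mono mult.assoc)
  qed
  then have "\<psi> 1 \<le> \<psi> 0"
    by (intro DERIV_nonpos_imp_nonincreasing[of 0 1]) auto
  then show ?thesis
    by (simp add: \<psi>_def d_def)
qed

section \<open>Existence and strong minimality of the prox-grad step\<close>

lemma convex_fun_le:
  assumes "convex_fun g" "g a \<le> ereal s" "g b \<le> ereal t" "0 \<le> u" "u \<le> 1"
  shows "g ((1 - u) *\<^sub>R a + u *\<^sub>R b) \<le> ereal ((1 - u) * s + u * t)"
  using convexD_alt[of "ereal_epigraph g" "(a, s)" "(b, t)" u] assms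
  by (simp add: convex_fun_def ereal_epigraph_def)

lemma proper_fun_real_point:
  assumes "proper_fun g"
  obtains a s where "g a = ereal s"
  using assms unfolding proper_fun_def by (metis ereal_cases)

text \<open>A hyperplane separates the closed convex epigraph from a point just below it. This
  supplies the lower bound that makes the prox objective coercive.\<close>

lemma affine_minorant:
  fixes g :: "'a::euclidean_space \<Rightarrow> ereal"
  assumes "closed_fun g" "convex_fun g" "proper_fun g"
  obtains p c where "\<And>y t. g y \<le> ereal t \<Longrightarrow> p \<bullet> y + c \<le> t"
proof -
  obtain a s where as: "g a = ereal s"
    using proper_fun_real_point[OF assms(3)] .
  then have "(a, s - 1) \<notin> ereal_epigraph g"
    by (simp add: ereal_epigraph_def)
  then have "\<exists>m b. m \<bullet> (a, s - 1) < b \<and> (\<forall>e\<in>ereal_epigraph g. b < m \<bullet> e)"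
    using assms(1,2) unfolding closed_fun_def convex_fun_def
    by (intro separating_hyperplane_closed_point)
  then obtain m b where m: "m \<bullet> (a, s - 1) < b" "\<And>e. e \<in> ereal_epigraph g \<Longrightarrow> b < m \<bullet> e"
    by blast
  obtain q r where qr: "m = (q, r)"
    by (cases m)
  have "b < m \<bullet> (a, s)"
    by (rule m(2)) (simp add: ereal_epigraph_def as)
  \<comment> \<open>The points \<open>(a, s - 1)\<close> and \<open>(a, s)\<close> differ only in
    height and lie on opposite sides, so the hyperplane is not vertical.\<close>
  with m(1) have "r > 0"
    by (simp add: qr algebra_simps)
  have "(- q /\<^sub>R r) \<bullet> y + b / r \<le> t" if "g y \<le> ereal t" for y t
  proof -
    have "b < m \<bullet> (y, t)"
      by (rule m(2)) (simp add: ereal_epigraph_def that)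
    then show ?thesis
      using \<open>r > 0\<close> by (simp add: qr field_simps)
  qed
  then show thesis
    using that by blast
qed

text \<open>Since \<open>g\<close> need not be continuous, the minimization is moved to its
  epigraph, where the objective becomes the continuous real function \<open>h\<close> of point and
  height. The sublevel set \<open>S\<close> is compact because the quadratic term dominates the
  affine minorant.\<close>

lemma prox_objective_attains_min:
  fixes g :: "'a::euclidean_space \<Rightarrow> ereal"
  assumes L: "L > 0" and g: "closed_fun g" "convex_fun g" "proper_fun g"
  obtains p where "\<And>y. ereal (c + q \<bullet> (p - x)) + g p + ereal (L / 2 * (norm (p - x))\<^sup>2)
    \<le> ereal (c + q \<bullet> (y - x)) + g y + ereal (L / 2 * (norm (y - x))\<^sup>2)"
proof -
  define h where "h = (\<lambda>(y, t). c + q \<bullet> (y - x) + t + L / 2 * (norm (y - x))\<^sup>2)"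
  obtain a s where as: "g a = ereal s"
    using proper_fun_real_point[OF g(3)] .
  obtain m b where m: "\<And>y t. g y \<le> ereal t \<Longrightarrow> m \<bullet> y + b \<le> t"
    using affine_minorant[OF g] by metis
  define S where "S = ereal_epigraph g \<inter> {e. h e \<le> h (a, s)}"
  have cont: "continuous_on A h" for A
    unfolding h_def by (auto intro!: continuous_intros simp: case_prod_unfold)
  have aS: "(a, s) \<in> S"
    by (simp add: S_def ereal_epigraph_def as)
  have "closed S"
    unfolding S_def using g(1)
    by (intro closed_Int closed_Collect_le cont continuous_on_const) (simp add: closed_fun_def)
  moreover have "bounded S"
  proof -
    \<comment> \<open>On \<open>S\<close>, the distance \<open>n\<close> from \<open>y\<close> to
      \<open>x\<close> satisfies \<open>L / 2 * n^2 \<le> A + B * n\<close>. For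
      \<open>n > 1\<close> the right side is at most \<open>(A + B) * n\<close>, which explains both
      entries of \<open>R\<close>.\<close>
    define A where "A = \<bar>h (a, s) - c - m \<bullet> x - b\<bar>"
    define B where "B = norm (m + q)"
    define R where "R = max 1 (2 * (A + B) / L)"
    have R: "norm (y - x) \<le> R" if "(y, t) \<in> S" for y t
    proof (rule ccontr)
      assume "\<not> ?thesis"
      then have n: "norm (y - x) > 1" "norm (y - x) > 2 * (A + B) / L"
        by (auto simp: R_def)
      have "m \<bullet> y + b \<le> t" "h (y, t) \<le> h (a, s)"
        using that m by (auto simp: S_def ereal_epigraph_def)
      then have "L / 2 * (norm (y - x))\<^sup>2 \<le> (h (a, s) - c - m \<bullet> x - b) + - ((m + q) \<bullet> (y - x))"
        by (simp add: h_def algebra_simps)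
      also have "\<dots> \<le> A + B * norm (y - x)"
        using Cauchy_Schwarz_ineq2[of "m + q" "y - x"] unfolding A_def B_def by linarith
      also have "\<dots> \<le> A * norm (y - x) + B * norm (y - x)"
        using n(1) mult_left_mono[of 1 "norm (y - x)" A] by (simp add: A_def)
      also have "\<dots> = (A + B) * norm (y - x)"
        by (simp add: algebra_simps)
      also have "\<dots> < (L / 2 * norm (y - x)) * norm (y - x)"
        using n L by (intro mult_strict_right_mono) (auto simp: field_simps)
      finally show False
        by (simp add: power2_eq_square)
    qed
    \<comment> \<open>\<open>T\<close> bounds the height: from below by the affine minorant, from
      above by the sublevel condition.\<close>
    define T where "T = norm m * (R + norm x) + \<bar>b\<bar> + \<bar>h (a, s) - c\<bar> + norm q * R"
    have "norm (y, t) \<le> R + norm x + T" if "(y, t) \<in> S" for y t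
    proof -
      have y: "norm y \<le> R + norm x"
        using R[OF that] norm_triangle_sub[of y x] by linarith
      have *: "m \<bullet> y + b \<le> t" "h (y, t) \<le> h (a, s)"
        using that m by (auto simp: S_def ereal_epigraph_def)
      have "L / 2 * (norm (y - x))\<^sup>2 \<ge> 0"
        using L by simp
      then have t: "t \<le> h (a, s) - c - q \<bullet> (y - x)"
        using *(2) unfolding h_def by simp
      have 1: "\<bar>m \<bullet> y\<bar> \<le> norm m * (R + norm x)"
        using Cauchy_Schwarz_ineq2[of m y] mult_left_mono[OF y, of "norm m"] by simp
      have 2: "\<bar>q \<bullet> (y - x)\<bar> \<le> norm q * R"
        using Cauchy_Schwarz_ineq2[of q "y - x"] mult_left_mono[OF R[OF that], of "norm q"] by simp
      have "\<bar>t\<bar> \<le> T"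
        using *(1) t 1 2 unfolding T_def by linarith
      with y show ?thesis
        using norm_Pair_le[of y t] by simp
    qed
    then show ?thesis
      by (intro boundedI[of _ "R + norm x + T"]) auto
  qed
  ultimately have "compact S"
    by (simp add: compact_eq_bounded_closed)
  moreover have "S \<noteq> {}"
    using aS by blast
  ultimately obtain e where e: "e \<in> S" "\<And>e'. e' \<in> S \<Longrightarrow> h e \<le> h e'"
    using continuous_attains_inf[of S h] cont by metis
  obtain p r where pr: "e = (p, r)"
    by (cases e)
  \<comment> \<open>Outside \<open>S\<close> the value exceeds \<open>h (a, s)\<close>, which is
    itself at least \<open>h e\<close>.\<close>
  have min: "h (p, r) \<le> h (y, t)" if "g y \<le> ereal t" for y t
    using e(2)[of "(y, t)"] e(2)[OF aS] that by (fastforce simp: S_def ereal_epigraph_def pr)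
  have gp: "g p \<le> ereal r"
    using e(1) by (simp add: S_def ereal_epigraph_def pr)
  have "ereal (c + q \<bullet> (p - x)) + g p + ereal (L / 2 * (norm (p - x))\<^sup>2)
    \<le> ereal (c + q \<bullet> (y - x)) + g y + ereal (L / 2 * (norm (y - x))\<^sup>2)" for y
  proof (cases "g y")
    case (real t)
    have "ereal (c + q \<bullet> (p - x)) + g p + ereal (L / 2 * (norm (p - x))\<^sup>2) \<le> ereal (h (p, r))"
      using gp by (cases "g p") (auto simp: h_def)
    also have "\<dots> \<le> ereal (h (y, t))"
      using min[of y t] real by simp
    finally show ?thesis
      by (simp add: h_def real)
  qed (use g(3) in \<open>auto simp: proper_fun_def\<close>)
  then show thesis
    using that by blast
qed

text \<open>\<open>arg_min\<close> is a Hilbert choice, so it is known to minimize only once a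
  minimizer exists.\<close>

lemma prox_grad_step_minimizes:
  fixes f :: "'a::euclidean_space \<Rightarrow> real" and g :: "'a \<Rightarrow> ereal" and x :: 'a
  assumes "L > 0" "closed_fun g" "convex_fun g" "proper_fun g"
  defines "p \<equiv> prox_grad_step L f g x"
  shows "ereal (f x + gradient f x \<bullet> (p - x)) + g p + ereal (L / 2 * (norm (p - x))\<^sup>2)
    \<le> ereal (f x + gradient f x \<bullet> (y - x)) + g y + ereal (L / 2 * (norm (y - x))\<^sup>2)"
proof -
  let ?h = "\<lambda>y. ereal (f x + gradient f x \<bullet> (y - x)) + g y + ereal (L / 2 * (norm (y - x))\<^sup>2)"
  obtain p' where "\<And>y. ?h p' \<le> ?h y"
    using prox_objective_attains_min[OF assms(1-4), of "f x" "gradient f x" x] by blast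
  then have "is_arg_min ?h (\<lambda>_. True) p'"
    by (simp add: is_arg_min_linorder)
  then have "is_arg_min ?h (\<lambda>_. True) p"
    unfolding p_def prox_grad_step_def arg_min_def by (rule someI)
  then show ?thesis
    by (simp add: is_arg_min_linorder)
qed

lemma prox_grad_step_finite:
  fixes f :: "'a::euclidean_space \<Rightarrow> real" and g :: "'a \<Rightarrow> ereal" and x :: 'a
  assumes "L > 0" "closed_fun g" "convex_fun g" "proper_fun g"
  obtains r where "g (prox_grad_step L f g x) = ereal r"
proof -
  obtain a s where "g a = ereal s"
    using proper_fun_real_point[OF assms(4)] .
  then have "g (prox_grad_step L f g x) \<noteq> \<infinity>"
    using prox_grad_step_minimizes[OF assms, of f x a] by auto
  moreover have "g (prox_grad_step L f g x) \<noteq> -\<infinity>"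
    using assms(4) by (simp add: proper_fun_def)
  ultimately show thesis
    using that by (cases "g (prox_grad_step L f g x)") auto
qed

text \<open>The extra term in \<open>y - p\<close> is the quadratic growth of a strongly convex
  objective. It comes from comparing \<open>p\<close> with points of the segment towards
  \<open>y\<close>, dividing by the step \<open>u\<close>, and letting \<open>u\<close> tend to
  0.\<close>

lemma prox_grad_step_strong_min:
  fixes f :: "'a::euclidean_space \<Rightarrow> real" and g :: "'a \<Rightarrow> ereal" and x :: 'a
  assumes L: "L > 0" and g: "closed_fun g" "convex_fun g" "proper_fun g"
  defines "p \<equiv> prox_grad_step L f g x"
  assumes gp: "g p = ereal r" and gy: "g y = ereal s"
  shows "gradient f x \<bullet> (p - x) + r + L / 2 * (norm (p - x))\<^sup>2 + L / 2 * (norm (y - p))\<^sup>2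
    \<le> gradient f x \<bullet> (y - x) + s + L / 2 * (norm (y - x))\<^sup>2"
    (is "?l + L / 2 * ?N \<le> ?r")
proof -
  \<comment> \<open>Moving the \<open>1 - u\<close> share of the left side across leaves a common
    factor \<open>u\<close>; plain real variables keep the algebra small.\<close>
  have expand: "u * (A + r + l * N\<^sub>1 + (1 - u) * (l * N)) \<le> u * (B + s + l * N\<^sub>2)"
    if "A + r + l * N\<^sub>1 \<le> ((1 - u) * A + u * B) + ((1 - u) * r + u * s)
      + l * ((1 - u) * N\<^sub>1 + u * N\<^sub>2 - u * (1 - u) * N)" for u l A B N N\<^sub>1 N\<^sub>2 :: real
    using that by (simp add: algebra_simps)
  have seg: "?l + (1 - u) * (L / 2 * ?N) \<le> ?r" if u: "0 < u" "u \<le> 1" for u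
  proof -
    define w where "w = (1 - u) *\<^sub>R p + u *\<^sub>R y"
    have gw: "g w \<le> ereal ((1 - u) * r + u * s)"
      unfolding w_def using u by (intro convex_fun_le g) (auto simp: gp gy)
    moreover have "g w \<noteq> -\<infinity>"
      using g(3) by (simp add: proper_fun_def)
    ultimately obtain t where t: "g w = ereal t"
      by (cases "g w") auto
    have "?l \<le> gradient f x \<bullet> (w - x) + t + L / 2 * (norm (w - x))\<^sup>2"
      using prox_grad_step_minimizes[OF L g, of f x w] gp unfolding p_def[symmetric]
      by (simp add: t)
    also have "\<dots> \<le> gradient f x \<bullet> (w - x) + ((1 - u) * r + u * s) + L / 2 * (norm (w - x))\<^sup>2"
      using gw t by simp
    also have "gradient f x \<bullet> (w - x) =
        (1 - u) * (gradient f x \<bullet> (p - x)) + u * (gradient f x \<bullet> (y - x))"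
      by (simp add: w_def algebra_simps)
    also have "(norm (w - x))\<^sup>2 =
        (1 - u) * (norm (p - x))\<^sup>2 + u * (norm (y - x))\<^sup>2 - u * (1 - u) * ?N"
      unfolding power2_norm_eq_inner w_def
      by (simp add: algebra_simps inner_commute)
    finally have "u * (?l + (1 - u) * (L / 2 * ?N)) \<le> u * ?r"
      by (rule expand)
    then show ?thesis
      using u by simp
  qed
  \<comment> \<open>The limit from the right turns the factor \<open>1 - u\<close> into 1.\<close>
  have "((\<lambda>u. ?l + (1 - u) * (L / 2 * ?N)) \<longlongrightarrow> ?l + (1 - 0) * (L / 2 * ?N)) (at_right 0)"
    by (intro tendsto_intros)
  moreover have "\<forall>\<^sub>F u in at_right 0. ?l + (1 - u) * (L / 2 * ?N) \<le> ?r"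
  proof (rule eventually_at_rightI[of 0 1])
    fix u :: real assume "u \<in> {0<..<1}"
    then show "?l + (1 - u) * (L / 2 * ?N) \<le> ?r"
      by (intro seg) auto
  qed simp
  ultimately have "?l + (1 - 0) * (L / 2 * ?N) \<le> ?r"
    by (rule tendsto_upperbound) simp
  then show ?thesis
    by simp
qed

text \<open>Sum of the tangent bound at \<open>x\<close>, the descent bound at \<open>p\<close> and
  strong minimality: the gradient terms cancel, and expanding the square of \<open>y - p\<close>
  with \<open>p = x - G / L\<close> produces the terms in \<open>G\<close>.\<close>

lemma prox_grad_inequality:
  fixes f :: "'a::euclidean_space \<Rightarrow> real" and g :: "'a \<Rightarrow> ereal" and x :: 'a
  assumes L: "L > 0" and f: "convex_on UNIV f" "L_smooth L f"
    and g: "closed_fun g" "convex_fun g" "proper_fun g"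
  defines "p \<equiv> prox_grad_step L f g x" and "G \<equiv> grad_map L f g x"
  assumes gp: "g p = ereal r" and gy: "g y = ereal s"
  shows "f p + r + G \<bullet> (y - x) + 1 / (2 * L) * (norm G)\<^sup>2 \<le> f y + s"
proof -
  have p: "p = x - (1 / L) *\<^sub>R G"
    using L by (simp add: G_def grad_map_def p_def)
  have "f x + gradient f x \<bullet> (y - x) \<le> f y"
    using f by (intro convex_on_above_gradient) (auto simp: L_smooth_def)
  moreover have "f p \<le> f x + gradient f x \<bullet> (p - x) + L / 2 * (norm (p - x))\<^sup>2"
    by (rule L_smooth_descent[OF f(2)])
  moreover have "gradient f x \<bullet> (p - x) + r + L / 2 * (norm (p - x))\<^sup>2 + L / 2 * (norm (y - p))\<^sup>2
      \<le> gradient f x \<bullet> (y - x) + s + L / 2 * (norm (y - x))\<^sup>2"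
    unfolding p_def using gp gy by (intro prox_grad_step_strong_min L g) (auto simp: p_def)
  moreover have "L / 2 * (norm (y - p))\<^sup>2 =
      L / 2 * (norm (y - x))\<^sup>2 + G \<bullet> (y - x) + 1 / (2 * L) * (norm G)\<^sup>2"
    using L unfolding power2_norm_eq_inner p
    by (simp add: field_simps inner_commute power2_eq_square inner_diff inner_add)
  ultimately show ?thesis
    by linarith
qed

section \<open>Decrease of the potential and the final bound\<close>

text \<open>Here \<open>A\<close>, \<open>A'\<close> and \<open>B\<close> stand for \<open>F y\<^sub>k\<close>, \<open>F y\<^sub>k\<^sub>+\<^sub>1\<close> and \<open>F w\<close>.\<close>

lemma potential_step:
  fixes G x y z w :: "'a::real_inner"
  assumes L: "L > 0" and \<phi>: "\<phi> > 0" "\<phi>' > 0" and \<tau>: "0 \<le> \<tau>" "\<tau> \<le> \<tau>'"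
    and a: "a = \<tau> * \<phi> - \<tau>' * \<phi>'" "a = \<phi>' * (\<tau>' - \<tau>) + 1" "a * (\<tau>' - \<tau>) \<le> \<tau>' / 2"
    and x: "x = (\<phi>' / \<phi>) *\<^sub>R y + (1 - \<phi>' / \<phi>) *\<^sub>R z"
    and y': "y' = x - (1 / L) *\<^sub>R G" and z': "z' = z - (a / L) *\<^sub>R G"
    and Ay: "A' + G \<bullet> (y - x) + 1 / (2 * L) * (norm G)\<^sup>2 \<le> A"
    and Aw: "A' + G \<bullet> (w - x) + 1 / (2 * L) * (norm G)\<^sup>2 \<le> B"
  shows "\<tau>' * (A' - B) + L * (((z' - y') /\<^sub>R \<phi>') \<bullet> (z' - w))
    \<le> \<tau> * (A - B) + L * (((z - y) /\<^sub>R \<phi>) \<bullet> (z - w))"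
proof -
  define v where "v = (z - y) /\<^sub>R \<phi>"
  define d where "d = \<tau>' - \<tau>"
  have y: "y = z - \<phi> *\<^sub>R v"
    using \<phi> by (simp add: v_def)
  \<comment> \<open>Both \<open>y\<close> and \<open>x\<close> lie on the line through
    \<open>z\<close> with direction \<open>v\<close>, at parameters \<open>\<phi>\<close> and
    \<open>\<phi>'\<close>.\<close>
  have xv: "x = z - \<phi>' *\<^sub>R v"
    unfolding x y using \<phi> by (simp add: algebra_simps)
  have "z' - y' = \<phi>' *\<^sub>R v - ((a - 1) / L) *\<^sub>R G"
    by (simp add: z' y' xv algebra_simps diff_divide_distrib)
  \<comment> \<open>The first recurrence says \<open>a - 1 = \<phi>' * d\<close>, so
    \<open>\<phi>'\<close> factors out and \<open>v\<close> also moves by a multiple of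
    \<open>G\<close>.\<close>
  also have "\<dots> = \<phi>' *\<^sub>R (v - (d / L) *\<^sub>R G)"
    unfolding a(2) by (simp add: d_def algebra_simps)
  finally have v': "(z' - y') /\<^sub>R \<phi>' = v - (d / L) *\<^sub>R G"
    using \<phi> by simp
  have cross: "L * ((v - (d / L) *\<^sub>R G) \<bullet> (z' - w)) =
      L * (v \<bullet> (z - w)) - a * (G \<bullet> v) - d * (G \<bullet> (z - w)) + a * d / L * (norm G)\<^sup>2"
    using L unfolding power2_norm_eq_inner z'
    by (simp add: field_simps inner_commute power2_eq_square inner_diff inner_add)
  have 1: "\<tau> * (A' + G \<bullet> (y - x) + 1 / (2 * L) * (norm G)\<^sup>2) \<le> \<tau> * A"
    using Ay \<tau> by (intro mult_left_mono)
  have 2: "d * (A' + G \<bullet> (w - x) + 1 / (2 * L) * (norm G)\<^sup>2) \<le> d * B"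
    using Aw \<tau> by (intro mult_left_mono) (auto simp: d_def)
  \<comment> \<open>The squared-norm term left by \<open>cross\<close> is absorbed: the weights
    \<open>\<tau>\<close> and \<open>d\<close> in the two tested inequalities add up to
    \<open>\<tau>'\<close>.\<close>
  have 3: "a * d / L * (norm G)\<^sup>2 \<le> \<tau>' / (2 * L) * (norm G)\<^sup>2"
    using divide_right_mono[OF a(3), of L] L by (intro mult_right_mono) (auto simp: d_def)
  have 4: "G \<bullet> (y - x) = (\<phi>' - \<phi>) * (G \<bullet> v)" "G \<bullet> (w - x) = \<phi>' * (G \<bullet> v) - G \<bullet> (z - w)"
    by (auto simp: y xv algebra_simps)
  \<comment> \<open>By the definition of \<open>a\<close>, all contributions of
    \<open>G \<bullet> v\<close> cancel.\<close>
  have 5: "\<tau> * ((\<phi>' - \<phi>) * (G \<bullet> v)) + d * (\<phi>' * (G \<bullet> v)) + a * (G \<bullet> v) = 0"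
    unfolding a(1) d_def by (simp add: algebra_simps)
  have \<tau>': "\<tau>' = \<tau> + d"
    by (simp add: d_def)
  have "\<tau>' * (A' - B) + L * ((v - (d / L) *\<^sub>R G) \<bullet> (z' - w)) \<le> \<tau> * (A - B) + L * (v \<bullet> (z - w))"
    using 1 2 3 5 unfolding cross 4 \<tau>' by (simp add: algebra_simps add_divide_distrib)
  then show ?thesis
    unfolding v' v_def[symmetric] .
qed

theorem theorem6:
  fixes L :: real
    and f :: "real ^ 'n \<Rightarrow> real"
    and g :: "real ^ 'n \<Rightarrow> ereal"
    and F :: "real ^ 'n \<Rightarrow> ereal"
    and F_star :: ereal
    and K :: nat
    and \<phi> \<tau> :: "nat \<Rightarrow> real"
    and x z :: "nat \<Rightarrow> real ^ 'n"
  assumes "L > 0"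
    and "convex_on UNIV f" and "L_smooth L f"
    and "closed_fun g" and "convex_fun g" and "proper_fun g"
    and "F = (\<lambda>y. ereal (f y) + g y)"
    and "F_star = (INF y. F y)"
    and "K \<ge> 1"
    and "\<forall>k\<le>K + 1. 0 \<le> \<phi> k"
    and "\<forall>k\<le>K. 0 \<le> \<tau> k"
    and "mono_on {0..K} \<tau>"
    and "\<phi> (K + 1) = 0" and "\<phi> K = 1" and "\<tau> K = 1"
    and "\<forall>k<K. \<tau> k * \<phi> k - \<tau> (k + 1) * \<phi> (k + 1) = \<phi> (k + 1) * (\<tau> (k + 1) - \<tau> k) + 1"
    and "\<forall>k<K. (\<tau> k * \<phi> k - \<tau> (k + 1) * \<phi> (k + 1)) * (\<tau> (k + 1) - \<tau> k) \<le> \<tau> (k + 1) / 2"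
    and "z 0 = x 0"
    and "\<forall>k\<le>K. x k =
           (\<phi> (k + 1) / \<phi> k) *\<^sub>R (case k of 0 \<Rightarrow> x 0 | Suc j \<Rightarrow> prox_grad_step L f g (x j))
           + (1 - \<phi> (k + 1) / \<phi> k) *\<^sub>R z k"
    and "\<forall>k<K. z (k + 1) =
           z k - ((\<tau> k * \<phi> k - \<tau> (k + 1) * \<phi> (k + 1)) / L) *\<^sub>R grad_map L f g (x k)"
  shows "ereal ((norm (grad_map L f g (x K)))\<^sup>2) \<le> ereal (2 * L * \<tau> 0) * (F (x 0) - F_star)"
proof -
  have prox: "L > 0" "convex_on UNIV f" "L_smooth L f" "closed_fun g" "convex_fun g" "proper_fun g"
    by fact+
  \<comment> \<open>The case 0 encodes the convention that the prox-grad point with index -1 is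
    \<open>x 0\<close>.\<close>
  define y where "y k = (case k of 0 \<Rightarrow> x 0 | Suc j \<Rightarrow> prox_grad_step L f g (x j))" for k
  define G where "G k = grad_map L f g (x k)" for k
  define a where "a k = \<tau> k * \<phi> k - \<tau> (Suc k) * \<phi> (Suc k)" for k
  have xk: "x k = (\<phi> (Suc k) / \<phi> k) *\<^sub>R y k + (1 - \<phi> (Suc k) / \<phi> k) *\<^sub>R z k" if "k \<le> K" for k
    using assms(19) that by (simp add: y_def)
  have zk: "z (Suc k) = z k - (a k / L) *\<^sub>R G k" if "k < K" for k
    using assms(20) that by (simp add: a_def G_def)
  have yS: "y (Suc k) = x k - (1 / L) *\<^sub>R G k" for k
    using prox(1) by (simp add: y_def G_def grad_map_def)
  have mono: "\<tau> k \<le> \<tau> (Suc k)" if "k < K" for k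
    using assms(12) that by (intro mono_onD[of "{0..K}" \<tau>]) auto
  have a: "a k = \<phi> (Suc k) * (\<tau> (Suc k) - \<tau> k) + 1" "a k * (\<tau> (Suc k) - \<tau> k) \<le> \<tau> (Suc k) / 2"
    if "k < K" for k
    using assms(16,17) that by (auto simp: a_def)
  have nn: "0 \<le> \<phi> k" "0 \<le> \<tau> k" if "k \<le> K" for k
    using assms(10,11) that by auto
  \<comment> \<open>For \<open>k < K\<close> the recurrence writes the product as 1 plus nonnegative
    terms. Positivity justifies dividing by \<open>\<phi> k\<close> and makes
    \<open>\<tau> 0\<close> nonzero.\<close>
  have "0 < \<tau> k * \<phi> k" if "k \<le> K" for k
  proof (cases "k = K")
    case False
    with that have k: "k < K"
      by simp
    then have "0 \<le> \<phi> (Suc k) * (\<tau> (Suc k) - \<tau> k)" "0 \<le> \<tau> (Suc k) * \<phi> (Suc k)"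
      using nn[of "Suc k"] mono[OF k] by auto
    with a(1)[OF k] show ?thesis
      unfolding a_def by linarith
  qed (use assms(14,15) in simp)
  then have pos: "0 < \<phi> k" "0 < \<tau> k" if "k \<le> K" for k
    using nn[OF that] that by (force simp: zero_less_mult_iff)+
  define w where "w = y (Suc K)"
  have F_nmi: "F u \<noteq> -\<infinity>" for u
    using prox(6) by (simp add: assms(7) proper_fun_def)
  have star: "F_star \<le> F u" for u
    unfolding assms(8) by (rule INF_lower) simp
  have gS: "\<exists>r. g (y (Suc k)) = ereal r" for k
    using prox_grad_step_finite[OF prox(1,4-6), of f "x k"] by (auto simp: y_def)
  then obtain rw where rw: "g w = ereal rw"
    unfolding w_def by blast
  show ?thesis
  \<comment> \<open>In the infinite case the right side is infinite, because
    \<open>\<tau> 0 > 0\<close> and \<open>F_star\<close> is not plus infinity.\<close>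
  proof (cases "g (x 0) = \<infinity> \<or> F_star = -\<infinity>")
    case True
    have "F_star \<noteq> \<infinity>"
      using star[of w] by (auto simp: assms(7) rw)
    then have "F (x 0) - F_star = \<infinity>"
      using True F_nmi[of "x 0"] by (cases "F (x 0)"; cases F_star) (auto simp: assms(7))
    then show ?thesis
      using pos(2)[of 0] prox(1) by simp
  next
    case False
    then obtain r0 where r0: "g (y 0) = ereal r0"
      using prox(6) by (cases "g (x 0)") (auto simp: y_def proper_fun_def)
    have fin: "\<exists>r. g (y k) = ereal r" for k
      using r0 gS by (cases k) auto
    \<comment> \<open>\<open>Fr\<close> is used only at points \<open>y k\<close>, where
      \<open>g\<close> is finite, so the default value of \<open>real_of_ereal\<close> at infinity
      never enters.\<close>
    define Fr where "Fr u = f u + real_of_ereal (g u)" for u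
    have ineq: "Fr (y (Suc k)) + G k \<bullet> (y j - x k) + 1 / (2 * L) * (norm (G k))\<^sup>2 \<le> Fr (y j)" for j k
    proof -
      obtain s t where "g (y j) = ereal s" "g (prox_grad_step L f g (x k)) = ereal t"
        using fin[of j] fin[of "Suc k"] by (auto simp: y_def)
      with prox_grad_inequality[OF prox this(2,1)] show ?thesis
        by (simp add: Fr_def G_def y_def)
    qed
    define U where "U k = \<tau> k * (Fr (y k) - Fr w) + L * (((z k - y k) /\<^sub>R \<phi> k) \<bullet> (z k - w))" for k
    have step: "U (Suc k) \<le> U k" if k: "k < K" for k
      unfolding U_def w_def
      by (rule potential_step[OF prox(1) pos(1) pos(1) nn(2) mono[OF k] a_def a[OF k] xk yS zk[OF k]
            ineq ineq]) (use k in simp_all)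
    have "U k \<le> U 0" if "k \<le> K" for k
      using that
    proof (induction k)
      case (Suc k)
      then show ?case
        using step[of k] by simp
    qed simp
    then have "U K \<le> U 0"
      by simp
    also have "U 0 = \<tau> 0 * (Fr (x 0) - Fr w)"
      by (simp add: U_def y_def assms(18))
    finally have UK: "U K \<le> \<tau> 0 * (Fr (x 0) - Fr w)" .
    \<comment> \<open>Here \<open>\<phi> (K + 1) = 0\<close> removes the \<open>y K\<close>
      component of \<open>x K\<close>.\<close>
    have zK: "z K = x K"
      using xk[of K] assms(13) by simp
    have "L *\<^sub>R (x K - w) = G K"
      using prox(1) by (simp add: w_def yS)
    then have "L * ((x K - y K) \<bullet> (x K - w)) = G K \<bullet> (x K - y K)"
      by (metis inner_commute inner_scaleR_right)
    \<comment> \<open>With \<open>\<tau> K = \<phi> K = 1\<close>, the inner product in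
      \<open>U K\<close> is exactly the one that \<open>ineq\<close> controls for both indices equal
      to \<open>K\<close>.\<close>
    then have "U K = Fr (y K) - Fr w - G K \<bullet> (y K - x K)"
      by (simp add: U_def zK assms(14,15) inner_diff_right)
    then have "1 / (2 * L) * (norm (G K))\<^sup>2 \<le> \<tau> 0 * (Fr (x 0) - Fr w)"
      using UK ineq[of K K] by (simp add: w_def)
    then have "(norm (G K))\<^sup>2 \<le> 2 * L * \<tau> 0 * (Fr (x 0) - Fr w)"
      using prox(1) by (simp add: field_simps)
    moreover obtain s where s: "F_star = ereal s"
      using False star[of w] by (cases F_star) (auto simp: assms(7) rw)
    \<comment> \<open>The unknown value at \<open>w\<close> is replaced by the infimum, which only
      enlarges the bound.\<close>
    moreover have "2 * L * \<tau> 0 * (Fr (x 0) - Fr w) \<le> 2 * L * \<tau> 0 * (Fr (x 0) - s)"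
      using star[of w] prox(1) pos(2)[of 0]
      by (intro mult_left_mono) (simp_all add: s assms(7) rw Fr_def)
    ultimately have "(norm (G K))\<^sup>2 \<le> 2 * L * \<tau> 0 * (Fr (x 0) - s)"
      by linarith
    then show ?thesis
      using r0 by (simp add: s assms(7) y_def G_def Fr_def)
  qed
qed

end
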